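(* Let $k$ and $p$ be positive integers and let $\mathcal{G}$ be a $k$-degenerate ordered graph with $n$ vertices. Then \[\overline{R}(\mathcal{G},\mathcal{K}_n(p))\le n^{(1+2/k)(k+1)^{\lceil \log p\rceil}-2/k}.\]
   Context: Logarithms are base 2. An ordered graph is a finite simple graph with a total ordering of its vertices; copies must preserve edges and orderings. A graph is $k$-degenerate if every subgraph has a vertex of degree at most $k$. $\mathcal{K}_n(p)$ is the ordered complete $p$-partite graph on $pn$ vertices whose $p$ color classes, each of size $n$, form $p$ consecutive disjoint intervals of the ordering (vertices in different classes are adjacent, vertices in the same class are not). $\mathcal{K}_N$ is the complete graph on $N$ totally ordered vertices, and $\overline{R}(\mathcal{G},\mathcal{H})$ is the smallest $N$ such that every red/blue coloring of the edges of $\mathcal{K}_N$ contains a blue copy of $\mathcal{G}$ or a red copy of $\mathcal{H}$. *)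

theory Defs
  imports Complex_Main "HOL-Library.Ramsey"
begin

text \<open>The ordering of the vertices is the one induced by the linear order on the vertex type.\<close>

datatype 'a ograph = OGraph (verts: "'a set") (edges: "'a set set")

definition ordered_graph :: "'a::linorder ograph \<Rightarrow> bool" where
  "ordered_graph G \<longleftrightarrow> finite (verts G) \<and> edges G \<subseteq> [verts G]\<^bsup>2\<^esup>"

definition degree :: "'a ograph \<Rightarrow> 'a \<Rightarrow> nat" where
  "degree G v = card {e \<in> edges G. v \<in> e}"

definition subgraph :: "'a::linorder ograph \<Rightarrow> 'a ograph \<Rightarrow> bool" where
  "subgraph H G \<longleftrightarrow> ordered_graph H \<and> verts H \<subseteq> verts G \<and> edges H \<subseteq> edges G"

text \<open>The subgraph without vertices has to be excluded here: it has no vertex of any degree.\<close>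

definition degenerate :: "nat \<Rightarrow> 'a::linorder ograph \<Rightarrow> bool" where
  "degenerate k G \<longleftrightarrow>
     (\<forall>H. subgraph H G \<and> verts H \<noteq> {} \<longrightarrow> (\<exists>v \<in> verts H. degree H v \<le> k))"

definition contains_copy :: "'b::linorder ograph \<Rightarrow> 'a::linorder ograph \<Rightarrow> bool" where
  "contains_copy H G \<longleftrightarrow>
     (\<exists>f. strict_mono_on (verts G) f \<and> f ` verts G \<subseteq> verts H \<and>
          (\<forall>e \<in> edges G. f ` e \<in> edges H))"

definition complete_ograph :: "nat \<Rightarrow> nat ograph" where
  "complete_ograph N = OGraph {..<N} ([{..<N}]\<^bsup>2\<^esup>)"

definition color_class :: "nat \<Rightarrow> nat \<Rightarrow> nat set" where
  "color_class n i = {i * n..<(i + 1) * n}"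

definition complete_multipartite :: "nat \<Rightarrow> nat \<Rightarrow> nat ograph" where
  "complete_multipartite n p =
     OGraph (\<Union>i<p. color_class n i)
       {{u, v} | u v i j. i < j \<and> j < p \<and> u \<in> color_class n i \<and> v \<in> color_class n j}"

datatype color = Red | Blue

definition color_subgraph :: "'a ograph \<Rightarrow> ('a set \<Rightarrow> color) \<Rightarrow> color \<Rightarrow> 'a ograph" where
  "color_subgraph K c a = OGraph (verts K) {e \<in> edges K. c e = a}"

definition ramsey_arrow :: "nat \<Rightarrow> 'a::linorder ograph \<Rightarrow> 'b::linorder ograph \<Rightarrow> bool" where
  "ramsey_arrow N G H \<longleftrightarrow>
     (\<forall>c. contains_copy (color_subgraph (complete_ograph N) c Blue) G \<or>
          contains_copy (color_subgraph (complete_ograph N) c Red) H)"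

definition ordered_ramsey :: "'a::linorder ograph \<Rightarrow> 'b::linorder ograph \<Rightarrow> nat" where
  "ordered_ramsey G H = (LEAST N. ramsey_arrow N G H)"

text \<open>The least number above exists for all ordered graphs.\<close>

lemma ordered_graph_complete_multipartite: "ordered_graph (complete_multipartite n p)"
proof -
  have "u \<noteq> v" if "u \<in> color_class n i" "v \<in> color_class n j" "i < j" for u v i j
  proof -
    have "(i + 1) * n \<le> j * n" using that(3) by (intro mult_right_mono) auto
    then show ?thesis using that by (auto simp: color_class_def)
  qed
  then show ?thesis
    by (fastforce simp: ordered_graph_def complete_multipartite_def color_class_def)
qed

lemma ex_strict_mono_on_finite:
  fixes V :: "'a::linorder set" and W :: "'b::linorder set"
  assumes "finite V" "finite W" "card V = card W"
  shows "\<exists>f. strict_mono_on V f \<and> f ` V \<subseteq> W"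
proof -
  define r where "r v = card {u \<in> V. u < v}" for v
  define f where "f v = sorted_list_of_set W ! r v" for v
  have r_less: "r u < r v" if "u \<in> V" "v \<in> V" "u < v" for u v
    unfolding r_def by (rule psubset_card_mono) (use that assms in auto)
  have r_bound: "r v < card W" if "v \<in> V" for v
    unfolding r_def assms(3)[symmetric] by (rule psubset_card_mono) (use that assms in auto)
  have "strict_mono_on V f"
  proof (rule strict_mono_onI)
    fix u v assume "u \<in> V" "v \<in> V" "u < v"
    then show "f u < f v"
      unfolding f_def
      using r_less r_bound strict_sorted_list_of_set[of W]
      by (auto simp: sorted_wrt_iff_nth_less)
  qed
  moreover have "f ` V \<subseteq> W"
    using r_bound assms(2) nth_mem[of _ "sorted_list_of_set W"] by (fastforce simp: f_def)
  ultimately show ?thesis by blast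
qed

lemma contains_copy_of_clique:
  assumes G: "ordered_graph G" and K: "finite (verts K)"
    and W: "W \<subseteq> verts K" "card W = card (verts G)" "[W]\<^bsup>2\<^esup> \<subseteq> edges K"
  shows "contains_copy K G"
proof -
  have "finite W" using K W(1) by (rule finite_subset[rotated])
  then obtain f where f: "strict_mono_on (verts G) f" "f ` verts G \<subseteq> W"
    using ex_strict_mono_on_finite[of "verts G" W] G W(2) by (auto simp: ordered_graph_def)
  have inj: "inj_on f (verts G)"
    using f(1) by (rule strict_mono_on_imp_inj_on)
  have "f ` e \<in> edges K" if "e \<in> edges G" for e
  proof -
    have "e \<in> [verts G]\<^bsup>2\<^esup>" using that G by (auto simp: ordered_graph_def)
    then have "f ` e \<in> [W]\<^bsup>2\<^esup>"
      using f(2) inj by (auto simp: nsets_def card_image inj_on_subset)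
    then show ?thesis using W(3) by blast
  qed
  then show ?thesis
    using f W(1) unfolding contains_copy_def by blast
qed

lemma ex_ramsey_arrow:
  assumes "ordered_graph G" "ordered_graph H"
  shows "\<exists>N. ramsey_arrow N G H"
proof -
  obtain N :: nat where
    N: "\<And>E. \<exists>R \<subseteq> {..<N}. card R = card (verts G) \<and> clique R E \<or>
                         card R = card (verts H) \<and> indep R E"
    using ramsey2[where 'a = nat, of "card (verts G)" "card (verts H)"]
    by (metis card_lessThan finite_lessThan order_refl)
  have "ramsey_arrow N G H"
    unfolding ramsey_arrow_def
  proof
    fix c
    obtain R where R: "R \<subseteq> {..<N}"
      and *: "card R = card (verts G) \<and> clique R {e. c e = Blue} \<or>
              card R = card (verts H) \<and> indep R {e. c e = Blue}"
      using N by blast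
    have pair: "e \<in> [{..<N}]\<^bsup>2\<^esup>" if "e \<in> [R]\<^bsup>2\<^esup>" for e
      using that R nsets_mono by blast
    from * show "contains_copy (color_subgraph (complete_ograph N) c Blue) G \<or>
          contains_copy (color_subgraph (complete_ograph N) c Red) H"
    proof (elim disjE conjE)
      assume "card R = card (verts G)" "clique R {e. c e = Blue}"
      then have "contains_copy (color_subgraph (complete_ograph N) c Blue) G"
        using R pair
        by (intro contains_copy_of_clique[OF assms(1), of _ R])
           (auto simp: color_subgraph_def complete_ograph_def clique_def elim!: nsets2_E)
      then show ?thesis ..
    next
      assume card: "card R = card (verts H)" and "indep R {e. c e = Blue}"
      then have "c e = Red" if "e \<in> [R]\<^bsup>2\<^esup>" for e
        using that color.exhaust by (auto simp: indep_def elim!: nsets2_E)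
      then have "contains_copy (color_subgraph (complete_ograph N) c Red) H"
        using R pair card
        by (intro contains_copy_of_clique[OF assms(2), of _ R])
           (auto simp: color_subgraph_def complete_ograph_def)
      then show ?thesis ..
    qed
  qed
  then show ?thesis ..
qed

end

theory Submission
  imports Defs
begin

text \<open>
  Suppose that \<open>W\<close> has \<open>n\<^sup>2 M ^ (k + 1)\<close> vertices and cut it into \<open>n\<close> consecutive intervals of size
  \<open>n M ^ (k + 1)\<close>, one for each vertex of \<open>G\<close>. Embed \<open>G\<close> greedily in blue, in an order in which each
  vertex has at most \<open>k\<close> neighbours before it, keeping for each vertex that is not yet embedded the set of
  candidates in its interval. If no two of the intervals contain sets of size \<open>M\<close> with only red edges
  between them, then fewer than \<open>M\<close> candidates for the current vertex shrink the candidate set of a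
  given neighbour by more than a factor \<open>M\<close>, so that the embedding never gets stuck. Otherwise we
  recurse into both sets of size \<open>M\<close>, each of which yields half of the colour classes. The exponent
  thus satisfies \<open>e\<^sub>0 = 1\<close> and \<open>e\<^sub>s\<^sub>+\<^sub>1 = (k + 1) e\<^sub>s + 2\<close>.
\<close>

section \<open>Degeneracy orderings\<close>

text \<open>Built from the back: the subgraph induced on \<open>S\<close> has a vertex of degree at
  most \<open>k\<close>, which is put last, and the rest of \<open>S\<close> is ordered by
  induction.\<close>

lemma degeneracy_ordering:
  assumes G: "ordered_graph G" and deg: "degenerate k G" and "S \<subseteq> verts G"
  shows "\<exists>xs. set xs = S \<and> distinct xs \<and>
    (\<forall>ys v zs. xs = ys @ v # zs \<longrightarrow> card {u \<in> set ys. {u, v} \<in> edges G} \<le> k)"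
  using \<open>S \<subseteq> verts G\<close>
proof (induction "card S" arbitrary: S)
  case 0
  then have "S = {}"
    using G by (auto simp: ordered_graph_def dest: finite_subset)
  then show ?case by auto
next
  case (Suc m)
  have finE: "finite (edges G)"
    using G unfolding ordered_graph_def by (meson finite_imp_finite_nsets finite_subset)
  have finS: "finite S" and "S \<noteq> {}"
    using Suc.hyps(2) by (auto intro: card_ge_0_finite)
  define H where "H = OGraph S {e \<in> edges G. e \<subseteq> S}"
  have "subgraph H G"
    using G Suc.prems finS by (auto simp: subgraph_def H_def ordered_graph_def nsets_def)
  then obtain v where v: "v \<in> S" "degree H v \<le> k"
    using deg \<open>S \<noteq> {}\<close> by (force simp: degenerate_def H_def)
  have "card {u \<in> S - {v}. {u, v} \<in> edges G} \<le> degree H v"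
    unfolding degree_def
  proof (rule card_inj_on_le)
    show "inj_on (\<lambda>u. {u, v}) {u \<in> S - {v}. {u, v} \<in> edges G}"
      by (auto simp: inj_on_def doubleton_eq_iff)
    show "(\<lambda>u. {u, v}) ` {u \<in> S - {v}. {u, v} \<in> edges G} \<subseteq> {e \<in> edges H. v \<in> e}"
      using v by (auto simp: H_def)
    show "finite {e \<in> edges H. v \<in> e}"
      using finE by (simp add: H_def)
  qed
  with v have low: "card {u \<in> S - {v}. {u, v} \<in> edges G} \<le> k" by linarith
  have "m = card (S - {v})"
    using Suc.hyps(2) v finS by simp
  then obtain xs where xs: "set xs = S - {v}" "distinct xs"
    "\<And>ys w zs. xs = ys @ w # zs \<Longrightarrow> card {u \<in> set ys. {u, w} \<in> edges G} \<le> k"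
    using Suc.hyps(1)[of "S - {v}"] Suc.prems by blast
  \<comment> \<open>Either \<open>zs\<close> is empty, so that \<open>w\<close> is the new vertex
    \<open>v\<close> and \<open>low\<close> applies, or the split lies inside
    \<open>xs\<close>.\<close>
  have "card {u \<in> set ys. {u, w} \<in> edges G} \<le> k" if "xs @ [v] = ys @ w # zs" for ys w zs
    using that xs low by (cases zs rule: rev_cases) auto
  then show ?case
    using xs v by (intro exI[of _ "xs @ [v]"]) auto
qed

section \<open>Counting and greedy embedding\<close>

text \<open>Union bound: by the strict inequality each \<open>x\<close> has at most
  \<open>q - 1\<close> neighbours in \<open>Y\<close>, so all of \<open>X\<close> together leaves at
  least \<open>card X\<close> elements of \<open>Y\<close> untouched.\<close>

lemma card_common_nonneighbours:
  fixes B :: "'b \<Rightarrow> 'c \<Rightarrow> bool"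
  assumes "finite X" "finite Y" and "\<And>x. x \<in> X \<Longrightarrow> card {y \<in> Y. B x y} < q"
    and "card X * q \<le> card Y"
  shows "card X \<le> card {y \<in> Y. \<forall>x\<in>X. \<not> B x y}"
proof -
  have "card (\<Union>x\<in>X. {y \<in> Y. B x y}) \<le> (\<Sum>x\<in>X. card {y \<in> Y. B x y})"
    using assms(1) by (rule card_UN_le)
  also have "card X + \<dots> = (\<Sum>x\<in>X. Suc (card {y \<in> Y. B x y}))"
    by (simp add: sum_Suc)
  also have "\<dots> \<le> (\<Sum>x\<in>X. q)"
    using assms(3) by (intro sum_mono) (simp add: Suc_le_eq)
  finally have *: "card X + card (\<Union>x\<in>X. {y \<in> Y. B x y}) \<le> card Y"
    using assms(4) by simp
  have "{y \<in> Y. \<forall>x\<in>X. \<not> B x y} = Y - (\<Union>x\<in>X. {y \<in> Y. B x y})"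
    by auto
  then show ?thesis
    using * diff_card_le_card_Diff[of "\<Union>x\<in>X. {y \<in> Y. B x y}" Y] assms(1,2) by simp
qed

text \<open>\<open>B\<close> stands for blue adjacency. The order is taken care of by the choice of
  the candidate sets \<open>C w\<close>, so only edges matter here. The guaranteed number of
  candidates for \<open>w\<close> drops by a factor \<open>M\<close> per embedded neighbour. At its
  turn at least \<open>M * n\<close> remain, against fewer than \<open>M\<close> bad ones for each
  of fewer than \<open>n\<close> later neighbours.\<close>

lemma greedy_embedding:
  fixes nb :: "'a \<Rightarrow> 'a \<Rightarrow> bool" and B :: "'b \<Rightarrow> 'b \<Rightarrow> bool" and C :: "'a \<Rightarrow> 'b set"
  assumes nb: "symp nb" "irreflp nb" and B: "symp B" and "distinct xs"
    and back_le: "\<And>ys v zs. xs = ys @ v # zs \<Longrightarrow> card {u \<in> set ys. nb u v} \<le> k"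
    and fin: "\<And>w. w \<in> set xs \<Longrightarrow> finite (C w)"
    and size: "\<And>w. w \<in> set xs \<Longrightarrow> M ^ (k + 1) * length xs \<le> card (C w)"
    and "M > 0"
    and dense: "\<And>u w X Y. \<lbrakk>u \<in> set xs; w \<in> set xs; u \<noteq> w; X \<subseteq> C u; Y \<subseteq> C w;
      card X = M; card Y = M\<rbrakk> \<Longrightarrow> \<exists>x\<in>X. \<exists>y\<in>Y. B x y"
  shows "\<exists>f. (\<forall>w\<in>set xs. f w \<in> C w) \<and> (\<forall>u\<in>set xs. \<forall>v\<in>set xs. nb u v \<longrightarrow> B (f u) (f v))"
proof -
  define n where "n = length xs"
  define d where "d ys w = card {u \<in> set ys. nb u w}" for ys w
  define D where "D f ys w = {x \<in> C w. \<forall>u\<in>set ys. nb u w \<longrightarrow> B (f u) x}" for f ys w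
  \<comment> \<open>For a vertex further back in \<open>zs\<close>, extend the prefix up to it and
    use \<open>back_le\<close> there. Hence the exponents \<open>k + 1 - d ys w\<close> of waiting
    vertices stay positive.\<close>
  have d_le: "d ys w \<le> k" if "xs = ys @ zs" "w \<in> set zs" for ys zs w
  proof -
    obtain as bs where "zs = as @ w # bs" using split_list[OF \<open>w \<in> set zs\<close>] by blast
    then have "card {u \<in> set (ys @ as). nb u w} \<le> k"
      using back_le[of "ys @ as" w bs] that by simp
    moreover have "d ys w \<le> card {u \<in> set (ys @ as). nb u w}"
      unfolding d_def by (rule card_mono) auto
    ultimately show ?thesis by linarith
  qed
  \<comment> \<open>The exponent is the reserve of factors \<open>M\<close> for \<open>w\<close>:
    enough for its remaining earlier neighbours and one more for its own turn.\<close>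
  have "\<exists>f. (\<forall>w\<in>set ys. f w \<in> C w) \<and> (\<forall>u\<in>set ys. \<forall>v\<in>set ys. nb u v \<longrightarrow> B (f u) (f v)) \<and>
      (\<forall>w\<in>set zs. M ^ (k + 1 - d ys w) * n \<le> card (D f ys w))" if "xs = ys @ zs" for ys zs
    using that
  proof (induction ys arbitrary: zs rule: rev_induct)
    case Nil
    then show ?case using size by (simp add: d_def D_def n_def)
  next
    case (snoc v ys)
    then have xs: "xs = ys @ v # zs" by simp
    from snoc.IH[OF xs] obtain f where f: "\<And>w. w \<in> set ys \<Longrightarrow> f w \<in> C w"
      "\<And>u w. \<lbrakk>u \<in> set ys; w \<in> set ys; nb u w\<rbrakk> \<Longrightarrow> B (f u) (f w)"
      "\<And>w. w \<in> set (v # zs) \<Longrightarrow> M ^ (k + 1 - d ys w) * n \<le> card (D f ys w)"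
      by metis
    have v: "v \<notin> set ys" "v \<notin> set zs" using \<open>distinct xs\<close> xs by auto
    have finD: "finite (D f ys w)" if "w \<in> set xs" for w
      using fin[OF that] by (simp add: D_def)
    \<comment> \<open>\<open>q w\<close> is what the invariant will demand of a neighbour
      \<open>w\<close> once \<open>v\<close> is embedded; an image of \<open>v\<close> in
      \<open>Bad w\<close> would break it.\<close>
    define q where "q w = M ^ (k - d ys w) * n" for w
    define Bad where "Bad w = {x \<in> D f ys v. card {y \<in> D f ys w. B x y} < q w}" for w
    have d_snoc: "d (ys @ [v]) w = (if nb v w then Suc (d ys w) else d ys w)" for w
    proof -
      have "{u \<in> set (ys @ [v]). nb u w} =
          (if nb v w then insert v {u \<in> set ys. nb u w} else {u \<in> set ys. nb u w})" by auto
      then show ?thesis using v by (simp add: d_def)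
    qed
    \<comment> \<open>Otherwise \<open>M\<close> bad images of \<open>v\<close> would share
      \<open>M\<close> candidates of \<open>w\<close> adjacent to none of them, contrary to
      \<open>dense\<close>.\<close>
    have card_Bad: "card (Bad w) < M" if w: "w \<in> set zs" "nb v w" for w
    proof (rule ccontr)
      assume "\<not> card (Bad w) < M"
      then obtain X where X: "X \<subseteq> Bad w" "card X = M"
        by (meson not_less obtain_subset_with_card_n)
      have "Suc (d ys w) \<le> k"
        using d_le[of "ys @ [v]" zs w] xs w d_snoc[of w] by simp
      then have "k + 1 - d ys w = Suc (k - d ys w)" by simp
      then have "card X * q w \<le> card (D f ys w)"
        using f(3)[of w] w X by (simp add: q_def mult.assoc)
      moreover have "finite X"
        using X \<open>M > 0\<close> card_ge_0_finite by blast
      moreover have "finite (D f ys w)"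
        using finD w xs by simp
      moreover have "card {y \<in> D f ys w. B x y} < q w" if "x \<in> X" for x
        using X(1) that by (auto simp: Bad_def)
      ultimately have "card X \<le> card {y \<in> D f ys w. \<forall>x\<in>X. \<not> B x y}"
        by (intro card_common_nonneighbours)
      then obtain Y where Y: "Y \<subseteq> {y \<in> D f ys w. \<forall>x\<in>X. \<not> B x y}" "card Y = M"
        unfolding X(2) by (rule obtain_subset_with_card_n)
      have "X \<subseteq> C v" "Y \<subseteq> C w"
        using X Y by (auto simp: Bad_def D_def)
      moreover have "v \<in> set xs" "w \<in> set xs" "v \<noteq> w"
        using xs w v by auto
      ultimately have "\<exists>x\<in>X. \<exists>y\<in>Y. B x y"
        using dense[of v w X Y] X Y by blast
      then show False
        using Y by blast
    qed
    have "card (\<Union>w\<in>{w \<in> set zs. nb v w}. Bad w) \<le> (\<Sum>w\<in>{w \<in> set zs. nb v w}. card (Bad w))"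
      by (rule card_UN_le) simp
    also have "\<dots> \<le> (\<Sum>w\<in>{w \<in> set zs. nb v w}. M)"
      using card_Bad by (intro sum_mono) (auto intro: less_imp_le)
    also have "\<dots> = card {w \<in> set zs. nb v w} * M"
      by simp
    also have "\<dots> \<le> length zs * M"
    proof (rule mult_right_mono)
      have "card {w \<in> set zs. nb v w} \<le> card (set zs)"
        by (rule card_mono) auto
      then show "card {w \<in> set zs. nb v w} \<le> length zs"
        using card_length[of zs] by linarith
    qed simp
    \<comment> \<open>Strict because \<open>v\<close> itself counts in \<open>n\<close> but not in
      \<open>zs\<close>.\<close>
    also have "\<dots> < M * n"
      using \<open>M > 0\<close> xs by (simp add: n_def algebra_simps)
    also have "\<dots> \<le> M ^ (k + 1 - d ys v) * n"
      using d_le[OF xs, of v] power_increasing[of 1 "k + 1 - d ys v" M] \<open>M > 0\<close>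
      by (intro mult_right_mono) auto
    also have "\<dots> \<le> card (D f ys v)"
      using f(3)[of v] by simp
    finally have "card (\<Union>w\<in>{w \<in> set zs. nb v w}. Bad w) < card (D f ys v)" .
    moreover have "finite (Bad w)" for w
      using finD[of v] xs by (simp add: Bad_def)
    then have "finite (\<Union>w\<in>{w \<in> set zs. nb v w}. Bad w)"
      by simp
    ultimately have "\<not> D f ys v \<subseteq> (\<Union>w\<in>{w \<in> set zs. nb v w}. Bad w)"
      using card_mono not_le by blast
    then obtain x where "x \<in> D f ys v" "\<And>w. \<lbrakk>w \<in> set zs; nb v w\<rbrakk> \<Longrightarrow> x \<notin> Bad w"
      by blast
    then have x: "x \<in> D f ys v"
      "\<And>w. \<lbrakk>w \<in> set zs; nb v w\<rbrakk> \<Longrightarrow> q w \<le> card {y \<in> D f ys w. B x y}"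
      by (auto simp: Bad_def not_less)
    define g where "g = f(v := x)"
    have D_snoc: "D g (ys @ [v]) w = {y \<in> D f ys w. nb v w \<longrightarrow> B x y}" for w
      using v by (auto simp: D_def g_def)
    have "M ^ (k + 1 - d (ys @ [v]) w) * n \<le> card (D g (ys @ [v]) w)" if "w \<in> set zs" for w
      using x(2)[of w] f(3)[of w] that by (auto simp: D_snoc d_snoc q_def)
    moreover have "g w \<in> C w" if "w \<in> set (ys @ [v])" for w
      using that f(1) x(1) by (auto simp: g_def D_def)
    moreover have "B (g u) (g w)" if "u \<in> set (ys @ [v])" "w \<in> set (ys @ [v])" "nb u w" for u w
    proof -
      have fx: "B (f u') x" if "u' \<in> set ys" "nb u' v" for u'
        using x(1) that by (auto simp: D_def)
      moreover have "B x (f w')" if "w' \<in> set ys" "nb v w'" for w'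
        using fx[of w'] that nb(1) B by (auto dest: sympD)
      moreover have "\<not> nb v v"
        using nb(2) by (auto simp: irreflp_def)
      ultimately show ?thesis
        using that f(2) v(1) by (auto simp: g_def)
    qed
    ultimately show ?case by (intro exI[of _ g]) blast
  qed
  from this[of xs "[]"] show ?thesis by auto
qed

section \<open>Consecutive blocks and red pairs\<close>

text \<open>The increasing enumeration of \<open>W\<close> carries the index intervals
  \<open>color_class L i\<close> to the blocks.\<close>

lemma consecutive_blocks:
  fixes W :: "'b::linorder set"
  assumes "finite W" "m * L \<le> card W"
  shows "\<exists>C. (\<forall>i<m. C i \<subseteq> W \<and> card (C i) = L) \<and>
    (\<forall>i j. i < j \<longrightarrow> j < m \<longrightarrow> (\<forall>x\<in>C i. \<forall>y\<in>C j. x < y))"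
proof -
  obtain e where e: "strict_mono_on {..<card W} e" "e ` {..<card W} \<subseteq> W"
    using ex_strict_mono_on_finite[of "{..<card W}" W] assms by auto
  have le: "(i + 1) * L \<le> j * L" if "i < j" for i j
    using that by (intro mult_right_mono) auto
  have sub: "color_class L i \<subseteq> {..<card W}" if "i < m" for i
    using le[OF that] assms(2) by (auto simp: color_class_def)
  have inj: "inj_on e {..<card W}"
    using e(1) by (rule strict_mono_on_imp_inj_on)
  have "card (e ` color_class L i) = L" if "i < m" for i
    using sub[OF that] inj by (simp add: card_image inj_on_subset color_class_def)
  moreover have "e a < e b"
    if "i < j" "j < m" "a \<in> color_class L i" "b \<in> color_class L j" for i j a b
  proof -
    have "a < b" using le[of i j] that by (auto simp: color_class_def)
    then show ?thesis
      using e(1) sub[of i] sub[of j] that by (auto simp: strict_mono_on_def)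
  qed
  ultimately show ?thesis
    using e(2) sub by (intro exI[of _ "\<lambda>i. e ` color_class L i"]) blast
qed

text \<open>Relative to a vertex set \<open>W\<close> with the colouring fixed, so that the
  recursion can pass to subsets.\<close>

definition blue_copy :: "('b::linorder set \<Rightarrow> color) \<Rightarrow> 'b set \<Rightarrow> 'a::linorder ograph \<Rightarrow> bool" where
  "blue_copy c W G \<longleftrightarrow> (\<exists>f. strict_mono_on (verts G) f \<and> f ` verts G \<subseteq> W \<and>
     (\<forall>e\<in>edges G. c (f ` e) = Blue))"

text \<open>The order is part of the relation so that families of classes found in \<open>X\<close>
  and in \<open>Y\<close> can be concatenated.\<close>

definition red_below :: "('b::linorder set \<Rightarrow> color) \<Rightarrow> 'b set \<Rightarrow> 'b set \<Rightarrow> bool" where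
  "red_below c X Y \<longleftrightarrow> (\<forall>x\<in>X. \<forall>y\<in>Y. x < y \<and> c {x, y} = Red)"

lemma blue_copy_mono: "blue_copy c W G \<Longrightarrow> W \<subseteq> W' \<Longrightarrow> blue_copy c W' G"
  unfolding blue_copy_def by blast

text \<open>The blocks follow the order of the vertices of \<open>G\<close>, so any choice of one
  element per block preserves the order and \<open>greedy_embedding\<close> only has to make the
  edges blue. Its hypothesis \<open>dense\<close> is what the absence of a red pair
  provides.\<close>

lemma blue_copy_or_red_pair:
  fixes G :: "'a::linorder ograph" and W :: "'b::linorder set"
  assumes G: "ordered_graph G" "degenerate k G" and "M > 0" and "finite W"
    and card: "card (verts G) * (M ^ (k + 1) * card (verts G)) \<le> card W"
    and no_blue: "\<not> blue_copy c W G"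
  shows "\<exists>X Y. X \<subseteq> W \<and> Y \<subseteq> W \<and> card X = M \<and> card Y = M \<and> red_below c X Y"
proof (rule ccontr)
  assume no_red: "\<not> ?thesis"
  define n where "n = card (verts G)"
  define nb where "nb u v \<longleftrightarrow> {u, v} \<in> edges G" for u v
  define B where "B x y \<longleftrightarrow> c {x, y} = Blue" for x y
  obtain C :: "nat \<Rightarrow> 'b set" where C: "\<And>i. i < n \<Longrightarrow> C i \<subseteq> W \<and> card (C i) = M ^ (k + 1) * n"
    "\<And>i j x y. \<lbrakk>i < j; j < n; x \<in> C i; y \<in> C j\<rbrakk> \<Longrightarrow> x < y"
    using consecutive_blocks[OF \<open>finite W\<close> card] unfolding n_def by metis
  \<comment> \<open>\<open>r\<close> numbers the vertices increasingly; vertex \<open>w\<close> is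
    assigned the block \<open>C (r w)\<close>.\<close>
  obtain r where r: "strict_mono_on (verts G) r" "r ` verts G \<subseteq> {..<n}"
    using ex_strict_mono_on_finite[of "verts G" "{..<n}"] G(1)
    unfolding ordered_graph_def n_def card_lessThan by blast
  obtain xs where xs: "set xs = verts G" "distinct xs"
    "\<And>ys v zs. xs = ys @ v # zs \<Longrightarrow> card {u \<in> set ys. nb u v} \<le> k"
    using degeneracy_ordering[OF G order_refl] unfolding nb_def by blast
  have len: "length xs = n"
    using xs distinct_card by (fastforce simp: n_def)
  have r_lt: "r w < n" if "w \<in> verts G" for w using r that by auto
  have sep: "x < y" if "u \<in> verts G" "v \<in> verts G" "u < v" "x \<in> C (r u)" "y \<in> C (r v)" for u v x y
    using C(2)[of "r u" "r v"] r r_lt that by (auto simp: strict_mono_on_def)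
  have dense: "\<exists>x\<in>X. \<exists>y\<in>Y. B x y"
    if u: "u \<in> set xs" "w \<in> set xs" "u \<noteq> w" "X \<subseteq> C (r u)" "Y \<subseteq> C (r w)" "card X = M" "card Y = M"
    for u w X Y
  proof (rule ccontr)
    assume "\<not> ?thesis"
    then have red: "c {x, y} = Red" if "x \<in> X" "y \<in> Y" for x y
      using that color.exhaust by (auto simp: B_def)
    have "X \<subseteq> W" "Y \<subseteq> W" using u xs C(1) r_lt by blast+
    \<comment> \<open>\<open>dense\<close> is symmetric but \<open>red_below\<close> is directed;
      the order of \<open>u\<close> and \<open>w\<close> decides which set lies below.\<close>
    moreover have "red_below c X Y \<or> red_below c Y X"
    proof (cases "u < w")
      case True
      then have "x < y" if "x \<in> X" "y \<in> Y" for x y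
        using that u sep[of u w x y] xs(1) by blast
      then show ?thesis using red by (simp add: red_below_def)
    next
      case False
      then have "w < u" using u by simp
      then have "y < x" if "x \<in> X" "y \<in> Y" for x y
        using that u sep[of w u y x] xs(1) by blast
      then have "red_below c Y X"
        using red unfolding red_below_def by (metis insert_commute)
      then show ?thesis ..
    qed
    ultimately show False using no_red u by blast
  qed
  have "symp nb" "symp B"
    by (simp_all add: symp_def nb_def B_def insert_commute)
  moreover have "irreflp nb"
    using G by (auto simp: irreflp_def nb_def ordered_graph_def nsets_def)
  moreover have "finite (C (r w))" "M ^ (k + 1) * length xs \<le> card (C (r w))" if "w \<in> set xs" for w
    using that xs(1) len C(1)[OF r_lt] finite_subset[OF _ \<open>finite W\<close>] by auto
  ultimately have "\<exists>f. (\<forall>w\<in>set xs. f w \<in> C (r w)) \<and>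
      (\<forall>u\<in>set xs. \<forall>v\<in>set xs. nb u v \<longrightarrow> B (f u) (f v))"
    using xs(2,3) \<open>M > 0\<close> dense by (intro greedy_embedding[where M = M and k = k])
  then obtain f where f: "\<And>w. w \<in> set xs \<Longrightarrow> f w \<in> C (r w)"
      "\<And>u v. \<lbrakk>u \<in> set xs; v \<in> set xs; nb u v\<rbrakk> \<Longrightarrow> B (f u) (f v)"
    by blast
  have "strict_mono_on (verts G) f"
    using f(1) sep xs by (auto simp: strict_mono_on_def)
  moreover have "f ` verts G \<subseteq> W"
    using f(1) xs C(1) r_lt by blast
  moreover have "c (f ` e) = Blue" if "e \<in> edges G" for e
  proof -
    have "e \<in> [verts G]\<^bsup>2\<^esup>" using that G by (auto simp: ordered_graph_def)
    then obtain u v where "e = {u, v}" "u \<in> verts G" "v \<in> verts G"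
      by (elim nsets2_E) auto
    then show ?thesis
      using f(2)[of u v] that xs by (simp add: nb_def B_def)
  qed
  ultimately show False
    using no_blue unfolding blue_copy_def by blast
qed

section \<open>The exponent and the recursion for the colour classes\<close>

fun ramsey_exponent :: "nat \<Rightarrow> nat \<Rightarrow> nat" where
  "ramsey_exponent k 0 = 1"
| "ramsey_exponent k (Suc s) = (k + 1) * ramsey_exponent k s + 2"

text \<open>The map sending \<open>e\<close> to \<open>(k + 1) * e + 2\<close> has the fixed point
  \<open>- 2 / k\<close>, so the distance from it is multiplied by \<open>k + 1\<close> in each
  step, starting at \<open>1 + 2 / k\<close>.\<close>

lemma ramsey_exponent_closed_form:
  assumes "k > 0"
  shows "real (ramsey_exponent k s) = (1 + 2 / real k) * real (k + 1) ^ s - 2 / real k"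
proof (induction s)
  case (Suc s)
  have "real (ramsey_exponent k (Suc s)) = real (k + 1) * real (ramsey_exponent k s) + 2"
    by (simp add: algebra_simps)
  also have "\<dots> = (1 + 2 / real k) * real (k + 1) ^ Suc s - real (k + 1) * (2 / real k) + 2"
    by (simp only: Suc.IH right_diff_distrib power_Suc mult.left_commute)
  also have "real (k + 1) * (2 / real k) = 2 + 2 / real k"
    using assms by (simp add: field_simps)
  finally show ?case by simp
qed simp

text \<open>Both sets of a red pair are just large enough for the induction hypothesis and inherit
  the absence of a blue copy. The classes from \<open>X\<close> are listed before those from
  \<open>Y\<close>.\<close>

lemma blue_copy_or_red_classes:
  fixes G :: "'a::linorder ograph" and W :: "'b::linorder set"
  assumes G: "ordered_graph G" "degenerate k G" "card (verts G) = n" "n > 0"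
    and "finite W" "n ^ ramsey_exponent k s \<le> card W" and "\<not> blue_copy c W G"
  shows "\<exists>A :: nat \<Rightarrow> 'b set. (\<forall>i<2 ^ s. A i \<subseteq> W \<and> card (A i) = n) \<and>
    (\<forall>i j. i < j \<longrightarrow> j < 2 ^ s \<longrightarrow> red_below c (A i) (A j))"
  using assms(5-)
proof (induction s arbitrary: W)
  case 0
  then obtain A where "A \<subseteq> W" "card A = n"
    by (auto intro: obtain_subset_with_card_n)
  \<comment> \<open>The only index is 0, so the condition on pairs is vacuous.\<close>
  then show ?case by (intro exI[of _ "\<lambda>_. A"]) auto
next
  case (Suc s)
  define M where "M = n ^ ramsey_exponent k s"
  \<comment> \<open>The recurrence is made to give exactly the size that
    \<open>blue_copy_or_red_pair\<close> demands for this \<open>M\<close>.\<close>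
  have "n ^ ramsey_exponent k (Suc s) = n * (M ^ (k + 1) * n)"
    by (simp add: M_def power_add power_mult[symmetric] power2_eq_square algebra_simps)
  then have large: "card (verts G) * (M ^ (k + 1) * card (verts G)) \<le> card W"
    using Suc.prems(2) G(3) by metis
  have "M > 0"
    using \<open>n > 0\<close> by (simp add: M_def)
  from blue_copy_or_red_pair[OF G(1,2) this Suc.prems(1) large Suc.prems(3)] obtain X Y where
    XY: "X \<subseteq> W" "Y \<subseteq> W" "card X = M" "card Y = M" "red_below c X Y"
    by blast
  have "finite X" "finite Y" using XY Suc.prems finite_subset by blast+
  moreover have "\<not> blue_copy c X G" "\<not> blue_copy c Y G"
    using XY Suc.prems blue_copy_mono by blast+
  ultimately have "\<exists>A :: nat \<Rightarrow> 'b set. (\<forall>i<2 ^ s. A i \<subseteq> X \<and> card (A i) = n) \<and>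
      (\<forall>i j. i < j \<longrightarrow> j < 2 ^ s \<longrightarrow> red_below c (A i) (A j))"
    "\<exists>B :: nat \<Rightarrow> 'b set. (\<forall>i<2 ^ s. B i \<subseteq> Y \<and> card (B i) = n) \<and>
      (\<forall>i j. i < j \<longrightarrow> j < 2 ^ s \<longrightarrow> red_below c (B i) (B j))"
    using Suc.IH XY(3,4) unfolding M_def by simp_all
  then obtain A B :: "nat \<Rightarrow> 'b set" where A: "\<And>i. i < 2 ^ s \<Longrightarrow> A i \<subseteq> X \<and> card (A i) = n"
      "\<And>i j. \<lbrakk>i < j; j < 2 ^ s\<rbrakk> \<Longrightarrow> red_below c (A i) (A j)"
    and B: "\<And>i. i < 2 ^ s \<Longrightarrow> B i \<subseteq> Y \<and> card (B i) = n"
      "\<And>i j. \<lbrakk>i < j; j < 2 ^ s\<rbrakk> \<Longrightarrow> red_below c (B i) (B j)"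
    by blast
  define A' :: "nat \<Rightarrow> 'b set" where "A' i = (if i < 2 ^ s then A i else B (i - 2 ^ s))" for i
  have upper: "i - 2 ^ s < 2 ^ s" if "i < 2 ^ Suc s" for i :: nat
    using that by (simp add: less_diff_conv2 not_less less_imp_diff_less)
  have "A' i \<subseteq> W \<and> card (A' i) = n" if "i < 2 ^ Suc s" for i
    using A(1)[of i] B(1)[OF upper[OF that]] XY(1,2) by (auto simp: A'_def)
  moreover have "red_below c (A' i) (A' j)" if "i < j" "j < 2 ^ Suc s" for i j
  proof -
    \<comment> \<open>By \<open>i < j\<close> this is the only mixed case; it follows from
      \<open>red_below c X Y\<close>.\<close>
    have "red_below c (A i) (B (j - 2 ^ s))" if "i < 2 ^ s" "\<not> j < 2 ^ s"
      using A(1)[OF that(1)] B(1)[OF upper[OF \<open>j < 2 ^ Suc s\<close>]] XY(5)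
      unfolding red_below_def by blast
    then show ?thesis
      using A(2)[of i j] B(2)[of "i - 2 ^ s" "j - 2 ^ s"] upper[OF that(2)] that(1)
      by (auto simp: A'_def)
  qed
  ultimately show ?case by blast
qed

section \<open>Ordered copies and the final bound\<close>

text \<open>Increasing maps of the single classes are glued; between different classes
  \<open>red_below\<close> gives both the order and the colour.\<close>

lemma contains_copy_complete_multipartite:
  fixes A :: "nat \<Rightarrow> nat set"
  assumes A: "\<And>i. i < p \<Longrightarrow> A i \<subseteq> {..<N} \<and> card (A i) = n"
    and red: "\<And>i j. \<lbrakk>i < j; j < p\<rbrakk> \<Longrightarrow> red_below c (A i) (A j)"
  shows "contains_copy (color_subgraph (complete_ograph N) c Red) (complete_multipartite n p)"
proof -
  have "\<exists>g. strict_mono_on (color_class n i) g \<and> g ` color_class n i \<subseteq> A i" if "i < p" for i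
    using A[OF that] by (intro ex_strict_mono_on_finite) (auto simp: color_class_def finite_subset)
  then obtain g where g: "\<And>i. i < p \<Longrightarrow> strict_mono_on (color_class n i) (g i)"
    "\<And>i. i < p \<Longrightarrow> g i ` color_class n i \<subseteq> A i"
    by metis
  \<comment> \<open>\<open>x div n\<close> recovers the index of the class of \<open>x\<close>; for
    \<open>n = 0\<close> all classes are empty.\<close>
  define f where "f x = g (x div n) x" for x
  have div: "x div n = i" if "x \<in> color_class n i" for x i
    using that by (auto simp: color_class_def mult.commute intro: div_nat_eqI)
  have f: "f x = g i x" "f x \<in> A i" if "x \<in> color_class n i" "i < p" for x i
    using that g(2)[of i] by (auto simp: f_def div)
  have "f x < f y" if "x \<in> color_class n i" "i < p" "y \<in> color_class n j" "j < p" "x < y" for x y i j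
  proof -
    have "i \<le> j" using div that div_le_mono[of x y n] by auto
    then consider "i = j" | "i < j" by linarith
    then show ?thesis
    proof cases
      case 1
      then show ?thesis using f g(1)[of i] that by (auto simp: strict_mono_on_def)
    next
      case 2
      then show ?thesis using f(2) red[of i j] that by (auto simp: red_below_def)
    qed
  qed
  then have "strict_mono_on (\<Union>i<p. color_class n i) f"
    by (auto simp: strict_mono_on_def)
  moreover have "f ` (\<Union>i<p. color_class n i) \<subseteq> {..<N}"
    using f(2) A by blast
  moreover have "{f u, f v} \<in> [{..<N}]\<^bsup>2\<^esup> \<and> c {f u, f v} = Red"
    if "i < j" "j < p" "u \<in> color_class n i" "v \<in> color_class n j" for u v i j
  proof -
    have uv: "f u \<in> A i" "f v \<in> A j" using f(2) that by auto
    then have "f u \<noteq> f v" "c {f u, f v} = Red"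
      using red[of i j] that by (auto simp: red_below_def)
    moreover have "f u < N" "f v < N"
      using uv A[of i] A[of j] that by auto
    ultimately show ?thesis by (simp add: nsets_def)
  qed
  ultimately show ?thesis
    unfolding contains_copy_def color_subgraph_def complete_ograph_def complete_multipartite_def
    by (intro exI[of _ f]) auto
qed

lemma contains_copy_blue:
  assumes "ordered_graph G" "blue_copy c {..<N} G"
  shows "contains_copy (color_subgraph (complete_ograph N) c Blue) G"
proof -
  obtain f where f: "strict_mono_on (verts G) f" "f ` verts G \<subseteq> {..<N}"
    "\<And>e. e \<in> edges G \<Longrightarrow> c (f ` e) = Blue"
    using assms(2) unfolding blue_copy_def by blast
  have "f ` e \<in> [{..<N}]\<^bsup>2\<^esup>" if "e \<in> edges G" for e
  proof -
    have "e \<in> [verts G]\<^bsup>2\<^esup>" using that assms(1) by (auto simp: ordered_graph_def)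
    then show ?thesis
      using f(2) strict_mono_on_imp_inj_on[OF f(1)]
      by (auto simp: nsets_def card_image inj_on_subset)
  qed
  then show ?thesis
    using f unfolding contains_copy_def color_subgraph_def complete_ograph_def by auto
qed

lemma ramsey_arrow_complete_multipartite:
  assumes G: "ordered_graph G" "degenerate k G" "card (verts G) = n" and "p \<le> 2 ^ s"
  shows "ramsey_arrow (n ^ ramsey_exponent k s) G (complete_multipartite n p)"
  unfolding ramsey_arrow_def
proof (rule allI, subst disj_commute, rule disjCI)
  fix c
  let ?N = "n ^ ramsey_exponent k s"
  assume "\<not> contains_copy (color_subgraph (complete_ograph ?N) c Blue) G"
  then have no_blue: "\<not> blue_copy c {..<?N} G"
    using contains_copy_blue[OF G(1)] by blast
  \<comment> \<open>A graph without vertices has a blue copy in any vertex set, by any map.\<close>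
  have "n > 0"
  proof (rule ccontr)
    assume "\<not> n > 0"
    then have "verts G = {}" "edges G = {}"
      using G by (auto simp: ordered_graph_def nsets_def)
    then show False using no_blue by (auto simp: blue_copy_def strict_mono_on_def)
  qed
  then obtain A :: "nat \<Rightarrow> nat set" where "\<And>i. i < 2 ^ s \<Longrightarrow> A i \<subseteq> {..<?N} \<and> card (A i) = n"
    "\<And>i j. \<lbrakk>i < j; j < 2 ^ s\<rbrakk> \<Longrightarrow> red_below c (A i) (A j)"
    using blue_copy_or_red_classes[OF G, of "{..<?N}" s c] no_blue by auto
  then show "contains_copy (color_subgraph (complete_ograph ?N) c Red) (complete_multipartite n p)"
    \<comment> \<open>Only the first \<open>p\<close> of the \<open>2 ^ s\<close> classes are
      kept.\<close>
    using \<open>p \<le> 2 ^ s\<close> by (intro contains_copy_complete_multipartite[of p A]) auto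
qed

lemma le_two_power_ceiling_log: "p \<le> 2 ^ nat \<lceil>log 2 (real p)\<rceil>" if "p > 0"
proof -
  have "real p = 2 powr log 2 (real p)" using that by simp
  also have "\<dots> \<le> 2 powr real (nat \<lceil>log 2 (real p)\<rceil>)"
    by (intro powr_mono real_nat_ceiling_ge) auto
  also have "\<dots> = real (2 ^ nat \<lceil>log 2 (real p)\<rceil>)"
    by (simp add: powr_realpow)
  finally show ?thesis by (simp only: of_nat_le_iff)
qed

theorem theorem11:
  fixes G :: "'a::linorder ograph" and k p n :: nat
  assumes "k > 0" and "p > 0"
    and "ordered_graph G" and "degenerate k G" and "card (verts G) = n"
  shows "real (ordered_ramsey G (complete_multipartite n p)) \<le>
    real n powr ((1 + 2 / real k) * real (k + 1) ^ nat \<lceil>log 2 (real p)\<rceil> - 2 / real k)"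
proof -
  define s where "s = nat \<lceil>log 2 (real p)\<rceil>"
  have "ordered_ramsey G (complete_multipartite n p) \<le> n ^ ramsey_exponent k s"
    unfolding ordered_ramsey_def s_def
    using assms by (intro Least_le ramsey_arrow_complete_multipartite le_two_power_ceiling_log)
  then have "real (ordered_ramsey G (complete_multipartite n p)) \<le> real n ^ ramsey_exponent k s"
    by (metis of_nat_le_iff of_nat_power)
  also have "\<dots> = real n powr real (ramsey_exponent k s)"
  proof (cases "n = 0")
    case True
    \<comment> \<open>Both sides are 0: \<open>0 powr x\<close> is 0, and splitting on
      \<open>s\<close> shows that the natural exponent is positive.\<close>
    then show ?thesis by (cases s) auto
  next
    case False
    then show ?thesis by (simp add: powr_realpow)
  qed
  finally show ?thesis
    unfolding ramsey_exponent_closed_form[OF \<open>k > 0\<close>] s_def .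
qed

end
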